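(* Let $\lambda>-1$ and $t\in\mathbb{R}$. The recurrence coefficients $\alpha_n=\alpha_n(t;\lambda)$ and $\beta_n=\beta_n(t;\lambda)$ of the monic orthogonal polynomials for the generalised Airy weight $\omega(x;t,\lambda)=x^{\lambda}\exp(-\tfrac13x^3+tx)$ on $(0,\infty)$ satisfy, for every $n\ge0$, the discrete system $$(2\alpha_n+\alpha_{n-1})\beta_n+(\alpha_{n+1}+2\alpha_n)\beta_{n+1}+\alpha_n^3-t\alpha_n=2n+\lambda+1,$$ \begin{align*} \beta_n^3&+(\beta_{n+1}+\beta_{n-1}-2\alpha_n\alpha_{n-1}-2t)\beta_n^2\\ &+\left\{(\beta_{n+1}+\alpha_n^2-t)(\beta_{n-1}+\alpha_{n-1}^2-t)+(\alpha_n+\alpha_{n-1})(2n+\lambda)\right\}\beta_n=n(n+\lambda). \end{align*}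
   Context: The monic orthogonal polynomials $P_n(x)=P_n(x;t,\lambda)$ ($\deg P_n=n$) satisfy $\int_0^\infty P_m(x)P_n(x)\,x^{\lambda}\exp(-\tfrac13x^3+tx)\,\mathrm{d}x=0$ for $m\ne n$. The recurrence coefficients are defined by $xP_n(x)=P_{n+1}(x)+\alpha_nP_n(x)+\beta_nP_{n-1}(x)$ with $P_{-1}=0$, $P_0=1$ (so $\beta_n>0$ for $n\ge1$), with the conventions $\beta_0=0$ and $\alpha_{-1}=\beta_{-1}=0$. *)

theory Defs
  imports "HOL-Analysis.Analysis" "HOL-Computational_Algebra.Polynomial"
begin

definition airy_weight :: "real \<Rightarrow> real \<Rightarrow> real \<Rightarrow> real" where
  "airy_weight t lam x = x powr lam * exp (- (1/3) * x ^ 3 + t * x)"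

text \<open>
  Sequences are indexed by \<open>int\<close> so that the index \<open>-1\<close> is available.
  For \<open>lam > -1\<close> every polynomial is integrable against the weight on the positive half-line,
  so the integral below never takes the default value of a non-integrable function.
\<close>

definition airy_monic_orthogonal :: "real \<Rightarrow> real \<Rightarrow> (int \<Rightarrow> real poly) \<Rightarrow> bool" where
  "airy_monic_orthogonal t lam P \<longleftrightarrow>
     P (-1) = 0 \<and> P 0 = 1 \<and>
     (\<forall>n\<ge>0. degree (P n) = nat n \<and> lead_coeff (P n) = 1) \<and>
     (\<forall>m\<ge>0. \<forall>n\<ge>0. m \<noteq> n \<longrightarrow>
        (LBINT x:{0<..}. poly (P m) x * poly (P n) x * airy_weight t lam x) = 0)"

text \<open>
  As \<open>P (-1) = 0\<close>, the recurrence at \<open>n = 0\<close> does not determine \<open>\<beta> 0\<close>; the values at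
  \<open>-1\<close> and \<open>\<beta> 0\<close> are conventions.
\<close>

definition recurrence_coefficients ::
    "(int \<Rightarrow> real poly) \<Rightarrow> (int \<Rightarrow> real) \<Rightarrow> (int \<Rightarrow> real) \<Rightarrow> bool" where
  "recurrence_coefficients P \<alpha> \<beta> \<longleftrightarrow>
     \<alpha> (-1) = 0 \<and> \<beta> (-1) = 0 \<and> \<beta> 0 = 0 \<and>
     (\<forall>n\<ge>0. \<forall>x. x * poly (P n) x =
        poly (P (n + 1)) x + \<alpha> n * poly (P n) x + \<beta> n * poly (P (n - 1)) x)"

end

theory Submission
  imports Defs "HOL-Real_Asymp.Real_Asymp"
begin

text \<open>
  Write \<open>w\<close> for the weight and \<open>L q\<close> for the integral of \<open>q w\<close> over the positive half-line.  The weight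
  satisfies the Pearson equation \<open>x w' = (lam + t x - x\<^sup>3) w\<close>, and integrating the derivative of
  \<open>x q w\<close> turns it into the identity \<open>L (x q' + (lam + 1 + t x - x\<^sup>3) q) = 0\<close> for all
  polynomials \<open>q\<close> (\<open>airy_functional_pearson\<close>).  Everything else is algebra with this identity,
  orthogonality and the three-term recurrence.

  The first equation is the identity for \<open>q = P\<^sub>n\<^sup>2\<close>.

  The second equation is the vanishing of a \<open>2 \<times> 2\<close> determinant: the pair of values
  \<open>(P\<^sub>n\<^sub>-\<^sub>1(0), P\<^sub>n(0))\<close> at the singular point of the Pearson equation solves two homogeneous linear
  equations whose coefficients are built from the recurrence coefficients.  These are the
  identities for \<open>q = P\<^sub>n Q\<close> and \<open>q = P\<^sub>n\<^sub>-\<^sub>1 Q\<close>, where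
  \<open>Q(x) = (P\<^sub>n\<^sub>-\<^sub>1(0) P\<^sub>n(x) - P\<^sub>n(0) P\<^sub>n\<^sub>-\<^sub>1(x)) / x\<close> is a multiple of the Christoffel-Darboux
  kernel at \<open>0\<close> (\<open>second_equation\<close>).  The pair is not \<open>(0, 0)\<close>, because consecutive orthogonal
  polynomials have no common root (\<open>no_common_root\<close>).
\<close>

section \<open>Orthogonal polynomials of a linear functional\<close>

text \<open>
  Only the algebra of a moment functional matters for the recurrence, so it is set up for any
  linear functional \<open>L\<close>.  At \<open>n = 0\<close> the truncated subtraction turns \<open>p (n - 1)\<close>
  into \<open>p 0\<close> instead of \<open>0\<close>; this does no harm, as the coefficient there is \<open>b 0 = 0\<close>.
\<close>

locale orthogonal_recurrence =
  fixes L :: "real poly \<Rightarrow> real"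
    and p :: "nat \<Rightarrow> real poly"
    and a b :: "nat \<Rightarrow> real"
  assumes L_add: "L (q + r) = L q + L r"
    and L_smult: "L (smult c q) = c * L q"
    and degree_p: "degree (p n) = n"
    and monic_p: "lead_coeff (p n) = 1"
    and orthogonal: "m \<noteq> n \<Longrightarrow> L (p m * p n) = 0"
    and norm_nonzero: "L (p n * p n) \<noteq> 0"
    and recurrence: "[:0, 1:] * p n = p (Suc n) + smult (a n) (p n) + smult (b n) (p (n - 1))"
    and b_0: "b 0 = 0"
begin

abbreviation sqnorm :: "nat \<Rightarrow> real" where "sqnorm n \<equiv> L (p n * p n)"

lemma p_0: "p 0 = 1"
  using degree_p[of 0] monic_p[of 0] by (metis degree_eq_zeroE lead_coeff_pCons(2) one_pCons)

lemma coeff_p_self: "coeff (p n) n = 1"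
  using monic_p[of n] by (simp only: degree_p)

lemma L_0: "L 0 = 0"
  using L_smult[of 0 0] by simp

lemma L_diff: "L (q - r) = L q - L r"
  using L_add[of "q - r" r] by simp

text \<open>
  The \<open>p k\<close> with \<open>k < m\<close> span the polynomials of degree below \<open>m\<close>; the induction strips
  off the multiple of \<open>p m\<close> that carries the leading term.
\<close>

lemma L_low_degree:
  assumes "degree q < m" "m \<le> n"
  shows "L (p n * q) = 0"
  using assms
proof (induction m arbitrary: q)
  case 0
  then show ?case by simp
next
  case (Suc m)
  define r where "r = q - smult (coeff q m) (p m)"
  have q: "q = r + smult (coeff q m) (p m)"
    by (simp add: r_def)
  have r_le: "degree r \<le> m"
    unfolding r_def using Suc.prems degree_p[of m]
    by (intro degree_diff_le) (auto intro: order_trans[OF degree_smult_le])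
  have coeff_r: "coeff r m = 0"
    using monic_p[of m] by (simp add: r_def degree_p)
  have "L (p n * r) = 0"
  proof (cases "r = 0")
    case True
    then show ?thesis by (simp add: L_0)
  next
    case False
    then have "degree r < m"
      using r_le coeff_r by (metis leading_coeff_0_iff le_neq_implies_less)
    then show ?thesis
      using Suc by simp
  qed
  moreover have "L (p n * p m) = 0"
    using Suc.prems by (intro orthogonal) simp
  ultimately show ?case
    by (subst q) (simp add: distrib_left L_add L_smult)
qed

lemma L_top_degree:
  assumes "degree q \<le> n"
  shows "L (p n * q) = coeff q n * sqnorm n"
proof (cases "n = 0")
  case True
  then obtain c where q: "q = [:c:]"
    using assms by (metis degree_0_id le_zero_eq degree_eq_zeroE)
  then show ?thesis
    using True q L_smult[of c 1] p_0 by (simp add: one_pCons)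
next
  case False
  define r where "r = q - smult (coeff q n) (p n)"
  have "degree r \<le> n"
    unfolding r_def using assms degree_p[of n]
    by (intro degree_diff_le) (auto intro: order_trans[OF degree_smult_le])
  moreover have "coeff r n = 0"
    using monic_p[of n] by (simp add: r_def degree_p)
  ultimately have "degree r < n"
    using False by (metis degree_0 leading_coeff_0_iff le_neq_implies_less neq0_conv)
  then have "L (p n * r) = 0"
    by (rule L_low_degree) simp
  moreover have "q = r + smult (coeff q n) (p n)"
    by (simp add: r_def)
  ultimately show ?thesis
    by (metis L_add L_smult add_0 distrib_left mult_smult_right)
qed

lemma L_x_mult_p: "L ([:0, 1:] * (p n * q)) =
    L (p (Suc n) * q) + a n * L (p n * q) + b n * L (p (n - 1) * q)"
proof -
  have "[:0, 1:] * (p n * q) = ([:0, 1:] * p n) * q"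
    by (simp only: mult.assoc)
  then show ?thesis
    by (simp only: recurrence distrib_right L_add mult_smult_left L_smult)
qed

text \<open>
  Both sides are \<open>L (x p\<^sub>n p\<^sub>n\<^sub>+\<^sub>1)\<close>, with the recurrence applied to one factor or to the other.
\<close>

lemma sqnorm_Suc: "sqnorm (Suc n) = b (Suc n) * sqnorm n"
proof -
  have "L ([:0, 1:] * (p (Suc n) * p n)) = b (Suc n) * sqnorm n"
    by (simp only: L_x_mult_p) (simp add: orthogonal)
  moreover have "L ([:0, 1:] * (p n * p (Suc n))) = sqnorm (Suc n)"
    by (simp only: L_x_mult_p) (cases n, simp_all add: orthogonal b_0)
  ultimately show ?thesis
    by (simp add: mult.commute)
qed

lemma L_x_diag: "L ([:0, 1:] * (p n * p n)) = a n * sqnorm n"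
  by (simp only: L_x_mult_p) (cases n, simp_all add: orthogonal b_0)

text \<open>
  The next three lemmas compute the entries of powers of the Jacobi matrix (the matrix of
  multiplication by \<open>x\<close> in the basis \<open>p\<close>) that enter the discrete system.
\<close>

lemma L_x2_diag:
  "L ([:0, 1:] ^ 2 * (p n * p n)) = (b (Suc n) + a n ^ 2 + b n) * sqnorm n"
proof (cases n)
  case 0
  have "L ([:0, 1:] ^ 2 * (p n * p n)) = L (([:0,1:] * p n) * ([:0,1:] * p n))"
    by (simp only: power2_eq_square ac_simps)
  also have "\<dots> = sqnorm (Suc n) + a n ^ 2 * sqnorm n"
    by (simp only: recurrence distrib_right distrib_left L_add mult_smult_left mult_smult_right L_smult)
      (simp add: 0 orthogonal b_0 power2_eq_square)
  finally show ?thesis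
    by (simp add: 0 b_0 sqnorm_Suc distrib_right)
next
  case (Suc k)
  have "L ([:0, 1:] ^ 2 * (p n * p n)) = L (([:0,1:] * p n) * ([:0,1:] * p n))"
    by (simp only: power2_eq_square ac_simps)
  also have "\<dots> = sqnorm (Suc n) + a n ^ 2 * sqnorm n + b n ^ 2 * sqnorm k"
    by (simp only: recurrence distrib_right distrib_left L_add mult_smult_left mult_smult_right L_smult)
      (simp add: Suc orthogonal power2_eq_square)
  finally show ?thesis
    by (simp add: Suc sqnorm_Suc algebra_simps power2_eq_square)
qed

lemma L_x2_subdiag:
  "L ([:0, 1:] ^ 2 * (p (Suc n) * p n)) = (a (Suc n) + a n) * sqnorm (Suc n)"
proof -
  have "L ([:0, 1:] ^ 2 * (p (Suc n) * p n)) = L (([:0,1:] * p (Suc n)) * ([:0,1:] * p n))"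
    by (simp only: power2_eq_square ac_simps)
  also have "\<dots> = a (Suc n) * sqnorm (Suc n) + b (Suc n) * a n * sqnorm n"
    by (simp only: recurrence distrib_right distrib_left L_add mult_smult_left mult_smult_right L_smult)
      (cases n, simp_all add: orthogonal b_0)
  finally show ?thesis
    by (simp add: sqnorm_Suc algebra_simps)
qed

lemma L_x3_diag:
  "L ([:0, 1:] ^ 3 * (p n * p n)) =
     ((2 * a n + a (n - 1)) * b n + (a (Suc n) + 2 * a n) * b (Suc n) + a n ^ 3) * sqnorm n"
proof -
  have split: "[:0, 1:] ^ 3 * (p n * p n) = [:0, 1:] * (([:0,1:] * p n) * ([:0,1:] * p n))"
    by (simp only: power3_eq_cube ac_simps)
  show ?thesis
  proof (cases n)
    case 0
    show ?thesis
      by (simp only: split recurrence distrib_right distrib_left L_add mult_smult_left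
            mult_smult_right L_smult L_x_mult_p)
        (simp add: 0 orthogonal b_0 sqnorm_Suc algebra_simps power3_eq_cube)
  next
    case (Suc k)
    show ?thesis
      by (simp only: split recurrence distrib_right distrib_left L_add mult_smult_left
            mult_smult_right L_smult L_x_mult_p)
        (cases k; simp add: Suc orthogonal b_0 sqnorm_Suc algebra_simps power3_eq_cube)
  qed
qed

lemma b_Suc_nonzero: "b (Suc n) \<noteq> 0"
  using sqnorm_Suc[of n] norm_nonzero[of "Suc n"] by auto

text \<open>
  As \<open>b\<close> does not vanish at positive indices, a common root of two consecutive polynomials would
  propagate down the recurrence to \<open>p 0 = 1\<close>.
\<close>

lemma no_common_root: "poly (p (Suc n)) x \<noteq> 0 \<or> poly (p n) x \<noteq> 0"
proof (induction n)
  case 0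
  then show ?case by (simp add: p_0)
next
  case (Suc n)
  have "x * poly (p (Suc n)) x =
      poly (p (Suc (Suc n))) x + a (Suc n) * poly (p (Suc n)) x + b (Suc n) * poly (p n) x"
    using arg_cong[OF recurrence[of "Suc n"], of "\<lambda>q. poly q x"] by simp
  then show ?case
    using Suc b_Suc_nonzero[of n] by auto
qed

end

section \<open>The discrete system as a consequence of the Pearson identity\<close>

text \<open>
  The Pearson identity \<open>L (x q' + (lam + 1 + t x - x\<^sup>3) q) = 0\<close> is the only trace that the Airy
  weight leaves in the algebra.
\<close>

locale airy_recurrence = orthogonal_recurrence +
  fixes t lam :: real
  assumes pearson:
    "L ([:0, 1:] * pderiv q) + (lam + 1) * L q + t * L ([:0, 1:] * q) - L ([:0, 1:] ^ 3 * q) = 0"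
begin

lemma pearson_product:
  "L ([:0, 1:] * (pderiv q * r)) + L ([:0, 1:] * (q * pderiv r)) + (lam + 1) * L (q * r)
     + t * L ([:0, 1:] * (q * r)) - L ([:0, 1:] ^ 3 * (q * r)) = 0"
  using pearson[of "q * r"]
  by (simp only: pderiv_mult distrib_left L_add) (simp add: mult.commute)

lemma degree_x_pderiv:
  fixes q :: "real poly"
  shows "degree q \<le> n \<Longrightarrow> degree ([:0, 1:] * pderiv q) \<le> n"
  by (cases "pderiv q = 0") (auto simp: degree_pderiv pderiv_eq_0_iff degree_pCons_eq_if)

lemma coeff_x_pderiv: "coeff ([:0, 1:] * pderiv q) n = of_nat n * coeff q n"
  by (cases n) (simp_all add: coeff_pderiv coeff_pCons)

lemma L_x_pderiv:
  assumes "degree q \<le> n"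
  shows "L ([:0, 1:] * (p n * pderiv q)) = of_nat n * coeff q n * sqnorm n"
  using L_top_degree[OF degree_x_pderiv[OF assms]]
  by (simp only: coeff_x_pderiv) (simp only: ac_simps)

text \<open>
  The Pearson identity for \<open>p\<^sub>n\<^sup>2\<close>: the terms with a derivative give \<open>2 * n\<close>, because
  \<open>x\<^sup>n\<close> has coefficient \<open>n\<close> in \<open>x p\<^sub>n'\<close>, and the rest is the diagonal of the Jacobi matrix
  and of its cube.
\<close>

theorem first_equation:
  "(2 * a n + a (n - 1)) * b n + (a (Suc n) + 2 * a n) * b (Suc n) + a n ^ 3 - t * a n
     = 2 * of_nat n + lam + 1"
proof -
  have D: "L ([:0, 1:] * (p n * pderiv (p n))) = of_nat n * sqnorm n"
    using L_x_pderiv[of "p n" n] by (simp add: degree_p coeff_p_self)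
  have D': "L ([:0, 1:] * (pderiv (p n) * p n)) = of_nat n * sqnorm n"
    using D by (simp only: mult.commute)
  have "((2 * a n + a (n - 1)) * b n + (a (Suc n) + 2 * a n) * b (Suc n) + a n ^ 3 - t * a n) * sqnorm n
     = (2 * of_nat n + lam + 1) * sqnorm n"
    using pearson_product[of "p n" "p n"]
    unfolding D D' L_x_diag L_x3_diag by (simp only: algebra_simps)
  then show ?thesis
    using norm_nonzero[of n] by simp
qed

text \<open>
  Put \<open>m = n + 1\<close>, \<open>u = p\<^sub>n(0)\<close>, \<open>v = p\<^sub>m(0)\<close> and \<open>R = u p\<^sub>m - v p\<^sub>n\<close>.  Since \<open>R\<close> vanishes at \<open>0\<close>,
  it is \<open>x Q\<close> with \<open>Q\<close> of degree at most \<open>n\<close>; up to a constant, \<open>Q\<close> is the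
  Christoffel-Darboux kernel at \<open>0\<close>.  In the Pearson identity for \<open>p\<^sub>m Q\<close> and for \<open>p\<^sub>n Q\<close>,
  a factor \<open>x\<close> in front of \<open>Q\<close> merges with it into \<open>R\<close>.  This lowers the cubic \<open>x\<^sup>3\<close> to
  \<open>x\<^sup>2\<close> and leaves two linear relations in \<open>u\<close> and \<open>v\<close> whose coefficients involve only
  the recurrence coefficients.  They have the nontrivial solution \<open>(u, v)\<close>, so their determinant
  vanishes, and that is the claim.
\<close>

theorem second_equation:
  fixes n :: nat
  defines "m \<equiv> Suc n"
  shows "b m ^ 3 + (b (Suc m) + b n - 2 * a m * a n - 2 * t) * b m ^ 2
    + ((b (Suc m) + a m ^ 2 - t) * (b n + a n ^ 2 - t) + (a m + a n) * (2 * of_nat m + lam)) * b m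
    = of_nat m * (of_nat m + lam)"
proof -
  define u v where "u = poly (p n) 0" and "v = poly (p m) 0"
  define R where "R = smult u (p m) - smult v (p n)"
  have "poly R 0 = 0"
    by (simp add: R_def u_def v_def)
  then obtain Q where Q: "R = [:0, 1:] * Q"
    unfolding poly_eq_0_iff_dvd by (auto elim: dvdE)
  have coeff_R: "coeff R m = u"
    using degree_p[of n] by (simp add: R_def coeff_p_self m_def coeff_eq_0)
  have "degree R \<le> m"
    unfolding R_def using degree_p[of n] degree_p[of m]
    by (intro degree_diff_le) (auto intro!: order_trans[OF degree_smult_le] simp: m_def)
  then have deg_Q: "degree Q \<le> n"
    by (cases "Q = 0") (auto simp: Q m_def degree_mult_eq)
  have coeff_Q: "coeff Q n = u"
    using coeff_R by (simp add: Q m_def coeff_pCons)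
  have LR: "L (q * R) = u * L (q * p m) - v * L (q * p n)" for q
    by (simp only: R_def right_diff_distrib L_diff mult_smult_right L_smult)
  have xQ: "L ([:0, 1:] * (q * Q)) = L (q * R)" for q
    by (simp only: Q ac_simps)
  have x3Q: "L ([:0, 1:] ^ 3 * (q * Q)) = L ([:0, 1:]^2 * (q * R))" for q
    by (simp only: Q ac_simps power3_eq_cube power2_eq_square)
  have low: "L (p m * q) = 0" if "degree q \<le> n" for q
    using that by (intro L_low_degree[of _ m]) (auto simp: m_def)
  have x2R: "L ([:0, 1:]^2 * (q * R)) = u * L ([:0, 1:]^2 * (q * p m)) - v * L ([:0, 1:]^2 * (q * p n))" for q
    using LR[of "[:0,1:]^2 * q"] by (simp only: mult.assoc)
  have hm: "sqnorm m = b m * sqnorm n"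
    by (simp add: m_def sqnorm_Suc)
  \<comment> \<open>The Pearson identity for \<open>p m * Q\<close>: \<open>Q\<close> and \<open>x Q'\<close> have degree below \<open>m\<close> and are
    orthogonal to \<open>p m\<close>.\<close>
  have d1: "L (pderiv (p m) * R) = - v * (of_nat m * sqnorm n)"
  proof -
    have deg: "degree (pderiv (p m)) \<le> n"
      by (simp add: degree_pderiv degree_p m_def)
    have "L (pderiv (p m) * p n) = of_nat m * sqnorm n"
      using L_top_degree[OF deg] coeff_p_self[of m] by (simp add: coeff_pderiv m_def mult.commute)
    moreover have "L (pderiv (p m) * p m) = 0"
      using low[OF deg] by (simp add: mult.commute)
    ultimately show ?thesis
      by (simp add: LR)
  qed
  have d2: "L ([:0, 1:] * (p m * pderiv Q)) = 0"
    using low[OF degree_x_pderiv[OF deg_Q]] by (simp only: ac_simps)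
  have d3: "L (p m * R) = u * sqnorm m"
    by (simp add: LR orthogonal m_def)
  have d4: "L ([:0, 1:]^2 * (p m * R)) = (u * (b (Suc m) + a m ^ 2 + b m) - v * (a m + a n)) * sqnorm m"
    unfolding x2R L_x2_diag using L_x2_subdiag[of n] by (simp add: m_def algebra_simps)
  have "(v * (of_nat m - b m * (a m + a n)) + u * b m * (b (Suc m) + a m ^ 2 + b m - t)) * sqnorm n = 0"
    using pearson_product[of "p m" Q]
    unfolding xQ x3Q d1 d2 d3 d4 low[OF deg_Q] hm by (simp add: algebra_simps)
  then have E1: "v * (of_nat m - b m * (a m + a n)) + u * b m * (b (Suc m) + a m ^ 2 + b m - t) = 0"
    using norm_nonzero[of n] by simp
  \<comment> \<open>The Pearson identity for \<open>p n * Q\<close>: the terms \<open>p n * x Q'\<close> and \<open>(lam + 1) * p n * Q\<close> now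
    survive, since \<open>Q\<close> has the coefficient \<open>u\<close> at \<open>x\<^sup>n\<close>.\<close>
  have e1: "L (pderiv (p n) * R) = 0"
  proof -
    have deg: "degree (pderiv (p n)) \<le> n - 1"
      by (simp add: degree_pderiv degree_p)
    have "L (p n * pderiv (p n)) = 0"
    proof (cases "n = 0")
      case True
      then have "pderiv (p n) = 0"
        by (simp add: pderiv_eq_0_iff degree_p)
      then show ?thesis by (simp add: L_0)
    next
      case False
      then show ?thesis
        using deg by (intro L_low_degree[of _ n]) auto
    qed
    moreover have "L (p m * pderiv (p n)) = 0"
      using deg by (intro low) simp
    ultimately show ?thesis
      by (simp only: LR, simp add: mult.commute)
  qed
  have e2: "L ([:0, 1:] * (p n * pderiv Q)) = of_nat n * u * sqnorm n"
    using L_x_pderiv[OF deg_Q] by (simp only: coeff_Q)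
  have e0: "L (p n * Q) = u * sqnorm n"
    using L_top_degree[OF deg_Q] by (simp only: coeff_Q)
  have e3: "L (p n * R) = - v * sqnorm n"
    by (simp add: LR orthogonal m_def)
  have e4: "L ([:0, 1:]^2 * (p n * R)) = (u * (a m + a n) * b m - v * (b m + a n ^ 2 + b n)) * sqnorm n"
    unfolding x2R L_x2_diag mult.commute[of "p n" "p m"] using L_x2_subdiag[of n] hm
    by (simp add: m_def algebra_simps)
  have "(u * (of_nat m + lam - b m * (a m + a n)) + v * (b m + a n ^ 2 + b n - t)) * sqnorm n = 0"
    using pearson_product[of "p n" Q]
    unfolding xQ x3Q e0 e1 e2 e3 e4 by (simp add: algebra_simps m_def)
  then have E2: "u * (of_nat m + lam - b m * (a m + a n)) + v * (b m + a n ^ 2 + b n - t) = 0"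
    using norm_nonzero[of n] by simp
  \<comment> \<open>Cramer's rule for a linear system with the nontrivial solution \<open>(u, v)\<close>.\<close>
  have det: "A * B - C * G = 0"
    if "v * A + u * C = 0" "u * B + v * G = 0" for A B C G :: real
  proof -
    have "u * (A * B - C * G) = A * (u * B + v * G) - G * (v * A + u * C)"
      and "v * (A * B - C * G) = B * (v * A + u * C) - C * (u * B + v * G)"
      by (simp_all add: algebra_simps)
    then have "u * (A * B - C * G) = 0" "v * (A * B - C * G) = 0"
      by (simp_all only: that mult_zero_right diff_self)
    moreover have "u \<noteq> 0 \<or> v \<noteq> 0"
      using no_common_root[of n 0] by (auto simp: u_def v_def m_def)
    ultimately show ?thesis
      by auto
  qed
  have "(of_nat m - b m * (a m + a n)) * (of_nat m + lam - b m * (a m + a n))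
     - (b m * (b (Suc m) + a m ^ 2 + b m - t)) * (b m + a n ^ 2 + b n - t) = 0"
    using E1 E2 by (intro det) (simp_all only: mult.assoc)
  then show ?thesis
    by (simp add: algebra_simps power2_eq_square power3_eq_cube)
qed

end

section \<open>The moment functional of the Airy weight\<close>

lemma airy_weight_shift:
  assumes "x > 0"
  shows "airy_weight t (lam + 1) x = x * airy_weight t lam x"
  using assms by (simp add: airy_weight_def powr_add)

text \<open>
  The integrand is that of Euler's integral for \<open>Gamma (lam + 1)\<close>; this is where \<open>lam > -1\<close>
  makes the singularity at \<open>0\<close> integrable.
\<close>

lemma set_integrable_Gamma:
  fixes lam :: real
  assumes "lam > -1"
  shows "set_integrable lborel {0<..} (\<lambda>x. x powr lam * exp (- x))"
proof -
  have "(\<integral>\<^sup>+x. ennreal (indicator {0..} x * x powr lam / exp x) \<partial>lborel) = ennreal (Gamma (lam + 1))"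
    using Gamma_conv_nn_integral_real[of "lam + 1"] assms by simp
  then have "integrable lborel (\<lambda>x::real. indicator {0..} x * x powr lam / exp x)"
    by (intro integrableI_nonneg) (auto simp del: ennreal_mult'')
  then have "set_integrable lborel {0..} (\<lambda>x. x powr lam * exp (- x))"
    by (simp add: set_integrable_def exp_minus divide_inverse mult.assoc)
  then show ?thesis
    by (rule set_integrable_subset) auto
qed

text \<open>
  With \<open>s = \<bar>t\<bar> + 2\<close> it suffices that \<open>s * x \<le> 3 * s\<^sup>2 + x\<^sup>3 / 3\<close>: the first summand
  alone suffices for \<open>x \<le> 3 * s\<close>, the second one beyond.  The cubic decay is thus traded for
  \<open>exp (- x)\<close>, for which integrability and decay are known.
\<close>

lemma cubic_exponent_bound:
  fixes x t :: real
  assumes "x > 0"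
  shows "- (1/3) * x ^ 3 + t * x \<le> 3 * (\<bar>t\<bar> + 2) ^ 2 - x"
proof -
  define s where "s = \<bar>t\<bar> + 2"
  have s: "s \<ge> 2" "t + 1 \<le> s" by (auto simp: s_def)
  have "s * x \<le> 3 * s ^ 2 + (1/3) * x ^ 3"
  proof (cases "x \<le> 3 * s")
    case True
    then have "s * x \<le> s * (3 * s)"
      using s by (intro mult_left_mono) auto
    then have "s * x \<le> 3 * s ^ 2"
      by (simp add: power2_eq_square mult.left_commute)
    moreover have "x ^ 3 \<ge> 0" using assms by simp
    ultimately show ?thesis by linarith
  next
    case False
    then have "3 * s \<le> x ^ 2"
      using s mult_mono[of "3 * s" x 1 x] by (simp add: power2_eq_square)
    then have "3 * s * x \<le> x ^ 2 * x"
      using assms by (intro mult_right_mono) auto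
    then have "s * x \<le> (1/3) * x ^ 3"
      by (simp add: power3_eq_cube power2_eq_square)
    then show ?thesis using zero_le_power2[of s] by linarith
  qed
  moreover have "(t + 1) * x \<le> s * x"
    using s assms by (intro mult_right_mono) auto
  ultimately show ?thesis
    unfolding s_def by (simp add: algebra_simps)
qed

lemma airy_weight_bound:
  assumes "x > 0"
  shows "airy_weight t lam x \<le> exp (3 * (\<bar>t\<bar> + 2) ^ 2) * (x powr lam * exp (- x))"
proof -
  have "exp (- (1/3) * x ^ 3 + t * x) \<le> exp (3 * (\<bar>t\<bar> + 2) ^ 2) * exp (- x)"
    using cubic_exponent_bound[OF assms, of t] by (simp flip: exp_add)
  then have "x powr lam * exp (- (1/3) * x ^ 3 + t * x) \<le> x powr lam * (exp (3 * (\<bar>t\<bar> + 2) ^ 2) * exp (- x))"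
    by (intro mult_left_mono) auto
  then show ?thesis
    by (simp only: airy_weight_def ac_simps)
qed

lemma airy_weight_nonneg: "airy_weight t lam x \<ge> 0"
  by (simp add: airy_weight_def)

lemma airy_weight_measurable [measurable]: "airy_weight t lam \<in> borel_measurable borel"
  unfolding airy_weight_def by measurable

lemma airy_weight_integrable:
  assumes "lam > -1"
  shows "set_integrable lborel {0<..} (airy_weight t lam)"
proof (rule set_integrable_bound)
  show "set_integrable lborel {0<..} (\<lambda>x. exp (3 * (\<bar>t\<bar> + 2) ^ 2) * (x powr lam * exp (- x)))"
    using set_integrable_Gamma[OF assms] by (intro set_integrable_mult_right) simp
  show "set_borel_measurable lborel {0<..} (airy_weight t lam)"
    unfolding set_borel_measurable_def by measurable
  show "AE x in lborel. x \<in> {0<..} \<longrightarrow> norm (airy_weight t lam x)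
      \<le> norm (exp (3 * (\<bar>t\<bar> + 2) ^ 2) * (x powr lam * exp (- x)))"
  proof (intro AE_I2 impI)
    fix x :: real
    assume "x \<in> {0<..}"
    then show "norm (airy_weight t lam x) \<le> norm (exp (3 * (\<bar>t\<bar> + 2) ^ 2) * (x powr lam * exp (- x)))"
      using airy_weight_bound[of x t lam] by (simp add: airy_weight_nonneg abs_mult)
  qed
qed

text \<open>
  The exponent \<open>lam\<close> is kept arbitrary in the induction, since the factor \<open>x\<close> of
  \<open>c + x * poly q x\<close> is absorbed into the weight by raising \<open>lam\<close> by one.
\<close>

lemma poly_airy_weight_integrable:
  assumes "lam > -1"
  shows "set_integrable lborel {0<..} (\<lambda>x. poly q x * airy_weight t lam x)"
  using assms
proof (induction q arbitrary: lam)
  case 0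
  then show ?case by (simp add: set_integrable_def)
next
  case (pCons c q)
  have "set_integrable lborel {0<..} (\<lambda>x. c * airy_weight t lam x + poly q x * airy_weight t (lam + 1) x)"
    using pCons airy_weight_integrable[OF pCons.prems]
    by (intro set_integral_add set_integrable_mult_right) auto
  then show ?case
    by (rule set_integrable_cong[THEN iffD1, rotated -1]) (auto simp: airy_weight_shift distrib_right distrib_left mult_ac)
qed

lemma poly_airy_weight_tendsto_at_top: "((\<lambda>x. poly q x * airy_weight t lam x) \<longlongrightarrow> 0) at_top"
proof (induction q arbitrary: lam)
  case 0
  then show ?case by simp
next
  case (pCons c q)
  have bound: "((\<lambda>x::real. exp (3 * (\<bar>t\<bar> + 2) ^ 2) * (x powr lam * exp (- x))) \<longlongrightarrow> 0) at_top"
    by (rule tendsto_mult_right_zero) real_asymp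
  have "(airy_weight t lam \<longlongrightarrow> 0) at_top"
    by (rule tendsto_sandwich[OF _ _ tendsto_const bound])
      (use airy_weight_bound airy_weight_nonneg
        in \<open>auto intro!: eventually_mono[OF eventually_gt_at_top[of 0]]\<close>)
  then have "((\<lambda>x. c * airy_weight t lam x + poly q x * airy_weight t (lam + 1) x) \<longlongrightarrow> c * 0 + 0) at_top"
    using pCons by (intro tendsto_intros)
  then show ?case
    by (rule filterlim_cong[THEN iffD1, rotated -1])
      (auto intro!: eventually_mono[OF eventually_gt_at_top[of 0]] simp: airy_weight_shift distrib_right distrib_left mult_ac)
qed

definition airy_functional :: "real \<Rightarrow> real \<Rightarrow> real poly \<Rightarrow> real" where
  "airy_functional t lam q = (LBINT x:{0<..}. poly q x * airy_weight t lam x)"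

lemma airy_functional_add:
  assumes "lam > -1"
  shows "airy_functional t lam (q + r) = airy_functional t lam q + airy_functional t lam r"
  using assms by (simp add: airy_functional_def poly_airy_weight_integrable distrib_right)

lemma airy_functional_smult: "airy_functional t lam (smult c q) = c * airy_functional t lam q"
  by (simp add: airy_functional_def mult.assoc)

text \<open>
  The integrand is nonnegative, and it vanishes only at the finitely many roots of \<open>q\<close>.
\<close>

lemma airy_functional_square_nonzero:
  assumes "lam > -1" "q \<noteq> 0"
  shows "airy_functional t lam (q * q) \<noteq> 0"
proof
  let ?f = "\<lambda>x. indicator {0<..} x *\<^sub>R (poly (q * q) x * airy_weight t lam x)"
  assume "airy_functional t lam (q * q) = 0"
  then have "integral\<^sup>L lborel ?f = 0"
    by (simp add: airy_functional_def set_lebesgue_integral_def)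
  moreover have "integrable lborel ?f"
    using poly_airy_weight_integrable[OF assms(1)] by (simp only: set_integrable_def)
  moreover have "AE x in lborel. 0 \<le> ?f x"
    by (auto simp: airy_weight_def indicator_def)
  ultimately have "AE x in lborel. ?f x = 0"
    by (simp only: integral_nonneg_eq_0_iff_AE)
  moreover have "AE x in lborel. x \<notin> {x. poly q x = 0}"
    using assms by (intro AE_not_in finite_imp_null_set_lborel poly_roots_finite)
  ultimately have "AE x::real in lborel. x \<notin> {0<..<1}"
    by eventually_elim (auto simp: airy_weight_def indicator_def)
  then have "emeasure lborel {0<..<1::real} = 0"
    by (subst (asm) AE_iff_measurable[of "{0<..<1::real}"]) auto
  then show False
    by simp
qed

text \<open>
  The function differentiated is \<open>x * q(x) * w(x)\<close> with \<open>w\<close> the weight of exponent \<open>lam\<close>.  The extra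
  factor \<open>x\<close> clears the denominator in \<open>w' = (lam / x - x\<^sup>2 + t) * w\<close>, so the derivative is
  again a polynomial times \<open>w\<close>.
\<close>

lemma airy_weight_shift_derivative:
  assumes "x > 0"
  shows "((\<lambda>x. poly q x * airy_weight t (lam + 1) x) has_real_derivative
    poly ([:0, 1:] * pderiv q + smult (lam + 1) q + smult t ([:0, 1:] * q) - [:0, 1:] ^ 3 * q) x
      * airy_weight t lam x) (at x)"
proof -
  have 1: "((\<lambda>x. x powr (lam + 1)) has_real_derivative (lam + 1) * x powr lam) (at x)"
    using has_real_derivative_powr[OF assms, of "lam + 1"] by simp
  have 2: "((\<lambda>x. exp (- (1/3) * x ^ 3 + t * x)) has_real_derivative
      (t - x ^ 2) * exp (- (1/3) * x ^ 3 + t * x)) (at x)"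
    by (auto intro!: derivative_eq_intros)
  have "((\<lambda>x. poly q x * airy_weight t (lam + 1) x) has_real_derivative
     poly (pderiv q) x * airy_weight t (lam + 1) x +
     poly q x * ((lam + 1) * airy_weight t lam x + (t - x ^ 2) * airy_weight t (lam + 1) x)) (at x)"
    unfolding airy_weight_def
    by (rule DERIV_cong[OF DERIV_mult[OF poly_DERIV DERIV_mult[OF 1 2]]]) (simp add: algebra_simps)
  then show ?thesis
    by (rule DERIV_cong)
      (simp only: airy_weight_shift[OF assms], simp add: algebra_simps power3_eq_cube power2_eq_square)
qed

text \<open>
  Integrating that derivative over the half-line leaves no boundary terms: at \<open>0\<close> the factor
  \<open>x powr (lam + 1)\<close> tends to \<open>0\<close> as \<open>lam > -1\<close>, at infinity the exponential wins.
\<close>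

lemma airy_functional_pearson:
  assumes lam: "lam > -1"
  shows "airy_functional t lam
    ([:0, 1:] * pderiv q + smult (lam + 1) q + smult t ([:0, 1:] * q) - [:0, 1:] ^ 3 * q) = 0"
    (is "airy_functional t lam ?D = 0")
proof -
  let ?F = "\<lambda>x. poly q x * airy_weight t (lam + 1) x"
  let ?f = "\<lambda>x. poly ?D x * airy_weight t lam x"
  have "(?F \<longlongrightarrow> poly q 0 * airy_weight t (lam + 1) 0) (at_right 0)"
  proof -
    have powr0: "((\<lambda>x::real. x powr (lam + 1)) \<longlongrightarrow> 0 powr (lam + 1)) (at_right 0)"
      using lam by (intro tendsto_powr') (auto intro!: eventually_at_rightI[of 0 1])
    have poly: "(poly q \<longlongrightarrow> poly q 0) (at_right 0)"
      by (intro tendsto_intros)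
    have exp: "((\<lambda>x. exp (- (1/3) * x ^ 3 + t * x)) \<longlongrightarrow> exp (- (1/3) * 0 ^ 3 + t * 0)) (at_right 0)"
      by (intro tendsto_intros)
    show ?thesis
      unfolding airy_weight_def by (intro tendsto_mult poly powr0 exp)
  qed
  then have at0: "(?F \<longlongrightarrow> 0) (at_right 0)"
    by (simp add: airy_weight_def)
  have "(LBINT x=ereal 0..\<infinity>. ?f x) = 0 - 0"
  proof (rule interval_integral_FTC_integrable)
    show "(?F has_vector_derivative ?f x) (at x)" if "ereal 0 < ereal x" for x
      using airy_weight_shift_derivative[of x q t lam] that
      by (simp only: has_real_derivative_iff_has_vector_derivative ereal_less_eq less_ereal.simps)
    show "isCont ?f x" if "ereal 0 < ereal x" for x
      using that unfolding airy_weight_def by (auto intro!: continuous_intros)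
    show "set_integrable lborel (einterval (ereal 0) \<infinity>) ?f"
      by (simp only: einterval_eq poly_airy_weight_integrable[OF lam])
    show "((?F \<circ> real_of_ereal) \<longlongrightarrow> 0) (at_right (ereal 0))"
      by (simp only: ereal_tendsto_simps at0)
    show "((?F \<circ> real_of_ereal) \<longlongrightarrow> 0) (at_left \<infinity>)"
      by (simp only: ereal_tendsto_simps poly_airy_weight_tendsto_at_top)
  qed simp
  then show ?thesis
    by (simp only: airy_functional_def interval_integral_to_infinity_eq diff_zero)
qed

section \<open>The recurrence coefficients of the Airy weight\<close>

lemma airy_recurrenceI:
  fixes P :: "int \<Rightarrow> real poly" and \<alpha> \<beta> :: "int \<Rightarrow> real"
  assumes lam: "lam > -1"
    and P: "airy_monic_orthogonal t lam P"
    and rec: "recurrence_coefficients P \<alpha> \<beta>"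
  shows "airy_recurrence (airy_functional t lam) (\<lambda>k. P (int k)) (\<lambda>k. \<alpha> (int k))
    (\<lambda>k. \<beta> (int k)) t lam"
proof
  note add = airy_functional_add[OF lam, of t] and smult = airy_functional_smult[of t lam]
  show "airy_functional t lam (q + r) = airy_functional t lam q + airy_functional t lam r" for q r
    by (rule add)
  show "airy_functional t lam (smult c q) = c * airy_functional t lam q" for c q
    by (rule smult)
  show "degree (P (int n)) = n" for n
    using P by (simp add: airy_monic_orthogonal_def)
  show monic: "lead_coeff (P (int n)) = 1" for n
    using P of_nat_0_le_iff unfolding airy_monic_orthogonal_def by blast
  show "airy_functional t lam (P (int m) * P (int n)) = 0" if "m \<noteq> n" for m n
    using P that by (simp add: airy_monic_orthogonal_def airy_functional_def)
  have "P (int n) \<noteq> 0" for n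
    using monic[of n] by auto
  then show "airy_functional t lam (P (int n) * P (int n)) \<noteq> 0" for n
    by (rule airy_functional_square_nonzero[OF lam])
  show b0: "\<beta> (int 0) = 0"
    using rec by (simp add: recurrence_coefficients_def)
  show "[:0, 1:] * P (int n) =
      P (int (Suc n)) + smult (\<alpha> (int n)) (P (int n)) + smult (\<beta> (int n)) (P (int (n - 1)))" for n
  proof (rule poly_ext)
    fix x
    have "x * poly (P (int n)) x = poly (P (int n + 1)) x + \<alpha> (int n) * poly (P (int n)) x
        + \<beta> (int n) * poly (P (int n - 1)) x"
      using rec by (simp add: recurrence_coefficients_def)
    then show "poly ([:0, 1:] * P (int n)) x = poly (P (int (Suc n)) + smult (\<alpha> (int n)) (P (int n))
        + smult (\<beta> (int n)) (P (int (n - 1)))) x"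
      using b0 by (cases n) (simp_all add: add.commute)
  qed
  show "airy_functional t lam ([:0, 1:] * pderiv q) + (lam + 1) * airy_functional t lam q
      + t * airy_functional t lam ([:0, 1:] * q) - airy_functional t lam ([:0, 1:] ^ 3 * q) = 0" for q
    using airy_functional_pearson[OF lam, of t q] smult[of "- 1" "[:0, 1:] ^ 3 * q"]
    by (simp only: diff_conv_add_uminus add smult smult_minus_left smult_1_left)
qed

theorem theorem3p12:
  fixes t lam :: real
    and P :: "int \<Rightarrow> real poly"
    and \<alpha> \<beta> :: "int \<Rightarrow> real"
    and n :: int
  assumes "lam > -1"
    and "airy_monic_orthogonal t lam P"
    and "recurrence_coefficients P \<alpha> \<beta>"
    and "n \<ge> 0"
  shows "((2 * \<alpha> n + \<alpha> (n - 1)) * \<beta> n + (\<alpha> (n + 1) + 2 * \<alpha> n) * \<beta> (n + 1)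
           + (\<alpha> n) ^ 3 - t * \<alpha> n = 2 * of_int n + lam + 1)
         \<and> ((\<beta> n) ^ 3
           + (\<beta> (n + 1) + \<beta> (n - 1) - 2 * \<alpha> n * \<alpha> (n - 1) - 2 * t) * (\<beta> n) ^ 2
           + ((\<beta> (n + 1) + (\<alpha> n) ^ 2 - t) * (\<beta> (n - 1) + (\<alpha> (n - 1)) ^ 2 - t)
              + (\<alpha> n + \<alpha> (n - 1)) * (2 * of_int n + lam)) * \<beta> n
         = of_int n * (of_int n + lam))"
proof -
  interpret airy_recurrence "airy_functional t lam" "\<lambda>k. P (int k)" "\<lambda>k. \<alpha> (int k)"
    "\<lambda>k. \<beta> (int k)" t lam
    using assms by (intro airy_recurrenceI)
  from \<open>n \<ge> 0\<close> obtain k where k: "n = int k"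
    using nonneg_int_cases by blast
  show ?thesis
  proof (cases k)
    case 0
    \<comment> \<open>With \<open>\<beta> 0 = 0\<close> the term with \<open>\<alpha> (- 1)\<close> drops out and the second equation is \<open>0 = 0\<close>.\<close>
    then show ?thesis
      using first_equation[of 0] b_0 by (simp add: k)
  next
    case (Suc j)
    then have idx: "n - 1 = int j" "n = int (Suc j)" "n + 1 = int (Suc (Suc j))" "n = int k"
      by (simp_all add: k)
    show ?thesis
      using first_equation[of "Suc j"] second_equation[of j]
      unfolding idx(1,3) unfolding idx(2) by simp
  qed
qed

end
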